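(* For all integers $w\ge 3$ and $m$ with $w\le m\le 3w$, we have $\nu(m,w)=2m-w$.
   Context: For $y \in \{0,1\}^n$, $\mathrm{wt}(y)$ is the number of nonzero coordinates, and $\mathcal{B}(n,w)=\{y\in\{0,1\}^n : \mathrm{wt}(y)\le w\}$. A domination graph is a bipartite graph $G=([m]\cup[n],E)$ with left vertex set $[m]$ and right vertex set $[n]$ having no isolated right vertices. An injective map $\varphi:\{0,1\}^m\to\mathcal{B}(n,w)$ is $G$-dominating if for every $x\in\{0,1\}^m$ and every edge $(i,j)\in E$: $x_i=0$ implies that the $j$-th coordinate of $\varphi(x)$ is $0$. An $(m,n,w)$-domination mapping is an injective map $\{0,1\}^m\to\mathcal{B}(n,w)$ that is $G$-dominating for some domination graph $G=([m]\cup[n],E)$. $\nu(m,w)$ denotes the minimum integer $n$ such that an $(m,n,w)$-domination mapping exists. *)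

theory Defs
  imports Main "HOL-Library.FuncSet"
begin

(* Vectors are functions restricted to the coordinate set {1..n} (extensional outside it). *)
definition cube :: "nat \<Rightarrow> (nat \<Rightarrow> nat) set" where
  "cube n = {1..n} \<rightarrow>\<^sub>E {0, 1}"

definition wt :: "nat \<Rightarrow> (nat \<Rightarrow> nat) \<Rightarrow> nat" where
  "wt n y = card {j \<in> {1..n}. y j \<noteq> 0}"

definition hamming_ball :: "nat \<Rightarrow> nat \<Rightarrow> (nat \<Rightarrow> nat) set" where
  "hamming_ball n w = {y \<in> cube n. wt n y \<le> w}"

(* An edge is a pair (left vertex, right vertex); the two sides are kept apart
   by the position in the pair. *)
definition domination_graph :: "nat \<Rightarrow> nat \<Rightarrow> (nat \<times> nat) set \<Rightarrow> bool" where
  "domination_graph m n E \<longleftrightarrow>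
     E \<subseteq> {1..m} \<times> {1..n} \<and> (\<forall>j\<in>{1..n}. \<exists>i\<in>{1..m}. (i, j) \<in> E)"

definition dominating ::
  "nat \<Rightarrow> (nat \<times> nat) set \<Rightarrow> ((nat \<Rightarrow> nat) \<Rightarrow> (nat \<Rightarrow> nat)) \<Rightarrow> bool" where
  "dominating m E \<phi> \<longleftrightarrow>
     (\<forall>x\<in>cube m. \<forall>(i, j)\<in>E. x i = 0 \<longrightarrow> \<phi> x j = 0)"

definition domination_mapping ::
  "nat \<Rightarrow> nat \<Rightarrow> nat \<Rightarrow> ((nat \<Rightarrow> nat) \<Rightarrow> (nat \<Rightarrow> nat)) \<Rightarrow> bool" where
  "domination_mapping m n w \<phi> \<longleftrightarrow>
     \<phi> \<in> cube m \<rightarrow> hamming_ball n w \<and> inj_on \<phi> (cube m) \<and>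
     (\<exists>E. domination_graph m n E \<and> dominating m E \<phi>)"

(* For w >= 1 the minimum exists: with n = 2^m - 1, use one right vertex for every
   nonempty set S of left vertices, adjacent exactly to S, and send the indicator
   vector of S to the unit vector at that vertex (and 0 to 0). *)
definition nu :: "nat \<Rightarrow> nat \<Rightarrow> nat" where
  "nu m w = (LEAST n. \<exists>\<phi>. domination_mapping m n w \<phi>)"

end

theory Submission
  imports Defs "HOL-Library.Code_Target_Nat"
begin

text \<open>
  Keep one edge per right vertex, so that the right vertices are split into fibres over the left ones.
  Every fibre is nonempty, since \<open>{i}\<close> and \<open>{}\<close> need different images. If \<open>w + 1\<close> fibres were
  singletons, the \<open>2^(w+1)\<close> subsets of the corresponding left vertices would compete for the
  \<open>2^(w+1) - 1\<close> subsets of size at most \<open>w\<close> of their fibres. So at most \<open>w\<close> fibres are singletons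
  and \<open>n \<ge> w + 2(m - w)\<close>.

  For the upper bound take \<open>w\<close> single fibres and \<open>m - w\<close> double ones; at most \<open>2w\<close> are double, and
  we may assume exactly \<open>2w\<close>. Such configurations can be added, so it suffices to treat \<open>w = 3, 4, 5\<close>.
  There the map is obtained from Hall's theorem, whose condition follows from a fractional matching
  which depends only on cardinalities. Subsets of the single left vertices must
  be mapped onto all subsets of their fibres, so they are mapped identically and left out of the matching.
\<close>

section \<open>Hall's theorem and its fractional form\<close>

text \<open>Induction on \<open>card X\<close>. If some proper nonempty \<open>Z\<close> has exactly
  as many neighbours as elements, \<open>Z\<close> is matched first and its neighbours are withheld
  from the rest. Otherwise every proper nonempty subset has a neighbour to spare, so any single edge
  may be fixed.\<close>

lemma hall_marriage:
  fixes N :: "'a \<Rightarrow> 'b set"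
  assumes "finite X" and "\<And>x. x \<in> X \<Longrightarrow> finite (N x)"
    and "\<And>Z. Z \<subseteq> X \<Longrightarrow> card Z \<le> card (\<Union> (N ` Z))"
  shows "\<exists>g. inj_on g X \<and> (\<forall>x\<in>X. g x \<in> N x)"
  using assms
proof (induction "card X" arbitrary: X N rule: less_induct)
  case less
  note fin = less.prems(1) and finN = less.prems(2) and hall = less.prems(3)
  show ?case
  proof (cases "X = {}")
    case True
    then show ?thesis by simp
  next
    case nonempty: False
    show ?thesis
    proof (cases "\<exists>Z. Z \<noteq> {} \<and> Z \<subset> X \<and> card Z = card (\<Union> (N ` Z))")
      case True
      then obtain Z where Z: "Z \<noteq> {}" "Z \<subset> X" "card Z = card (\<Union> (N ` Z))"
        by blast
      then have finZ: "finite Z" and subZ: "Z \<subseteq> X"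
        using fin finite_subset by auto
      have "card Z < card X"
        using Z(2) fin by (rule psubset_card_mono[rotated])
      moreover have "card W \<le> card (\<Union> (N ` W))" if "W \<subseteq> Z" for W
        using that subZ by (intro hall) auto
      ultimately obtain g1 where g1: "inj_on g1 Z" "\<forall>x\<in>Z. g1 x \<in> N x"
        using less.hyps[of Z N] finN finZ subZ by blast
      define M where "M = (\<lambda>x. N x - \<Union> (N ` Z))"
      have "card W \<le> card (\<Union> (M ` W))" if W: "W \<subseteq> X - Z" for W
      proof -
        have finW: "finite W" using W fin finite_subset by blast
        \<comment> \<open>Hall's condition is applied to \<open>W \<union> Z\<close>; the tightness
          of \<open>Z\<close> then cancels \<open>card Z\<close>.\<close>
        have "card W + card Z = card (W \<union> Z)"
          using W finW finZ by (subst card_Un_disjoint) auto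
        also have "\<dots> \<le> card (\<Union> (N ` (W \<union> Z)))"
          using W subZ by (intro hall) auto
        also have "\<Union> (N ` (W \<union> Z)) = \<Union> (M ` W) \<union> \<Union> (N ` Z)"
          by (auto simp: M_def)
        also have "card \<dots> \<le> card (\<Union> (M ` W)) + card (\<Union> (N ` Z))"
          by (rule card_Un_le)
        finally show ?thesis using Z by simp
      qed
      moreover have "card (X - Z) < card X"
        using Z fin by (intro psubset_card_mono) auto
      moreover have "finite (M z)" if "z \<in> X - Z" for z
        using that finN by (simp add: M_def)
      ultimately obtain g2 where g2: "inj_on g2 (X - Z)" "\<forall>x\<in>X - Z. g2 x \<in> M x"
        using less.hyps[of "X - Z" M] fin by blast
      let ?g = "\<lambda>x. if x \<in> Z then g1 x else g2 x"
      have "g1 x \<noteq> g2 z" if "x \<in> Z" "z \<in> X - Z" for x z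
      proof -
        have "g1 x \<in> \<Union> (N ` Z)" using g1(2) that(1) by blast
        moreover have "g2 z \<notin> \<Union> (N ` Z)" using g2(2) that(2) by (simp add: M_def)
        ultimately show ?thesis by metis
      qed
      then have "inj_on ?g X"
        using inj_onD[OF g1(1)] inj_onD[OF g2(1)] by (intro inj_onI) (auto split: if_splits, metis)
      moreover have "\<forall>x\<in>X. ?g x \<in> N x"
        using g1 g2 by (auto simp: M_def)
      ultimately show ?thesis by blast
    next
      case False
      obtain x where x: "x \<in> X" using nonempty by blast
      have "card {x} \<le> card (\<Union> (N ` {x}))"
        using x by (intro hall) auto
      then obtain y where y: "y \<in> N x"
        by (cases "N x = {}") auto
      define M where "M = (\<lambda>z. N z - {y})"
      have "card W \<le> card (\<Union> (M ` W))" if W: "W \<subseteq> X - {x}" for W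
      proof (cases "W = {}")
        case nonempty: False
        have "W \<subset> X" using W x by blast
        \<comment> \<open>The inequality is strict since no proper nonempty subset is tight; this
          pays for the loss of \<open>y\<close>.\<close>
        then have "card W \<noteq> card (\<Union> (N ` W))" "card W \<le> card (\<Union> (N ` W))"
          using False nonempty hall[of W] by blast+
        moreover have "\<Union> (M ` W) = \<Union> (N ` W) - {y}"
          by (auto simp: M_def)
        moreover have "card (\<Union> (N ` W)) - card {y} \<le> card (\<Union> (N ` W) - {y})"
          by (rule diff_card_le_card_Diff) simp
        ultimately show ?thesis by simp
      qed simp
      moreover have "card (X - {x}) < card X"
        using x fin by (intro psubset_card_mono) auto
      moreover have "finite (M z)" if "z \<in> X - {x}" for z
        using that finN by (simp add: M_def)
      ultimately obtain g where g: "inj_on g (X - {x})" "\<forall>z\<in>X - {x}. g z \<in> M z"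
        using less.hyps[of "X - {x}" M] fin by blast
      have "inj_on (g(x := y)) X"
        using g by (auto simp: inj_on_def M_def)
      moreover have "\<forall>z\<in>X. (g(x := y)) z \<in> N z"
        using g y by (auto simp: M_def)
      ultimately show ?thesis by blast
    qed
  qed
qed

text \<open>Double counting gives Hall's condition for the graph of positive weights: the rows of
  \<open>Z\<close> carry at least \<open>card Z * K\<close>, all of it in neighbouring columns, and
  each of these takes at most \<open>K\<close>.\<close>

lemma fractional_matching:
  fixes f :: "'a \<Rightarrow> 'b \<Rightarrow> nat"
  assumes fin: "finite X" "finite Y" and K: "0 < K"
    and row: "\<And>x. x \<in> X \<Longrightarrow> K \<le> (\<Sum>y\<in>Y. f x y)"
    and col: "\<And>y. y \<in> Y \<Longrightarrow> (\<Sum>x\<in>X. f x y) \<le> K"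
  shows "\<exists>g. inj_on g X \<and> (\<forall>x\<in>X. g x \<in> Y \<and> 0 < f x (g x))"
proof -
  define N where "N = (\<lambda>x. {y\<in>Y. 0 < f x y})"
  have "card Z \<le> card (\<Union> (N ` Z))" if Z: "Z \<subseteq> X" for Z
  proof -
    have sub: "\<Union> (N ` Z) \<subseteq> Y" by (auto simp: N_def)
    have "card Z * K \<le> (\<Sum>x\<in>Z. \<Sum>y\<in>Y. f x y)"
      using Z row by (intro sum_bounded_below[of Z K, simplified]) auto
    also have "\<dots> = (\<Sum>x\<in>Z. \<Sum>y\<in>\<Union> (N ` Z). f x y)"
      using sub fin by (intro sum.cong sum.mono_neutral_right) (auto simp: N_def)
    also have "\<dots> = (\<Sum>y\<in>\<Union> (N ` Z). \<Sum>x\<in>Z. f x y)"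
      by (rule sum.swap)
    also have "\<dots> \<le> (\<Sum>y\<in>\<Union> (N ` Z). K)"
    proof (rule sum_mono)
      fix y assume "y \<in> \<Union> (N ` Z)"
      then have "(\<Sum>x\<in>X. f x y) \<le> K" using sub col by blast
      moreover have "(\<Sum>x\<in>Z. f x y) \<le> (\<Sum>x\<in>X. f x y)"
        using Z fin by (intro sum_mono2) auto
      ultimately show "(\<Sum>x\<in>Z. f x y) \<le> K" by simp
    qed
    finally show ?thesis using K by simp
  qed
  then have "\<exists>g. inj_on g X \<and> (\<forall>x\<in>X. g x \<in> N x)"
    using fin by (intro hall_marriage) (auto simp: N_def)
  then show ?thesis by (auto simp: N_def)
qed

section \<open>Sums over subsets by cardinality\<close>

text \<open>This is the sum of \<open>f (card X)\<close> over all subsets \<open>X\<close> of an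
  \<open>n\<close>-element set, in a form that can be evaluated on numerals.\<close>

definition binsum :: "nat \<Rightarrow> (nat \<Rightarrow> nat) \<Rightarrow> nat" where
  "binsum n f = (\<Sum>k\<le>n. (n choose k) * f k)"

lemma sum_Pow_card:
  assumes "finite S"
  shows "(\<Sum>X\<in>Pow S. f (card X)) = binsum (card S) f"
proof -
  have "(\<Sum>X\<in>Pow S. f (card X)) = (\<Sum>k\<le>card S. \<Sum>X | X \<in> Pow S \<and> card X = k. f (card X))"
    using assms by (intro sum.group[symmetric]) (auto intro: card_mono)
  also have "\<dots> = (\<Sum>k\<le>card S. \<Sum>X | X \<subseteq> S \<and> card X = k. f k)"
    by (intro sum.cong) auto
  also have "\<dots> = binsum (card S) f"
    using assms by (simp add: binsum_def n_subsets)
  finally show ?thesis .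
qed

text \<open>A set between \<open>T\<close> and \<open>S\<close> is \<open>T\<close> together with an
  arbitrary subset of \<open>S - T\<close>.\<close>

lemma sum_supersets_card:
  assumes "finite S" "T \<subseteq> S"
  shows "(\<Sum>X | T \<subseteq> X \<and> X \<subseteq> S. f (card X)) = binsum (card S - card T) (\<lambda>i. f (card T + i))"
proof -
  have fin: "finite T" using assms finite_subset by blast
  have "(\<Sum>X | T \<subseteq> X \<and> X \<subseteq> S. f (card X)) = (\<Sum>I\<in>Pow (S - T). f (card T + card I))"
    by (rule sum.reindex_bij_witness[of _ "\<lambda>I. T \<union> I" "\<lambda>X. X - T"])
       (use assms fin in \<open>auto simp: card_Diff_subset intro!: arg_cong[of _ _ f] le_add_diff_inverse
          card_mono intro: finite_subset\<close>)
  also have "\<dots> = binsum (card (S - T)) (\<lambda>i. f (card T + i))"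
    using assms by (intro sum_Pow_card) auto
  also have "card (S - T) = card S - card T"
    using assms fin by (simp add: card_Diff_subset)
  finally show ?thesis .
qed

section \<open>From fractional weights to an injection\<close>

text \<open>\<open>A\<close> and \<open>B\<close> are the left vertices with one and two right neighbours. A set of right vertices
  is the pair of its two layers, the second layer living over \<open>B\<close> only.\<close>

definition dominable :: "'a set \<Rightarrow> 'a set \<Rightarrow> nat \<Rightarrow> bool" where
  "dominable A B w \<longleftrightarrow> (\<exists>\<phi>. inj_on \<phi> (Pow (A \<union> B)) \<and>
     (\<forall>S\<in>Pow (A \<union> B). fst (\<phi> S) \<subseteq> S \<and> snd (\<phi> S) \<subseteq> S \<inter> B \<and>
        card (fst (\<phi> S)) + card (snd (\<phi> S)) \<le> w))"

text \<open>A target set is encoded as \<open>(T, E, R, Q)\<close>: its support is \<open>T\<close> in \<open>A\<close> and \<open>E\<close> in \<open>B\<close>; it contains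
  both right vertices over \<open>R\<close>, only the first over \<open>Q\<close>, and only the second over the rest of \<open>E\<close>.
  The fractional matching sends \<open>r s d * v a e\<close> from a source with \<open>s\<close> elements in \<open>A\<close> and \<open>d\<close> in \<open>B\<close>
  to each admissible target with support sizes \<open>a\<close> and \<open>e\<close>.\<close>

lemma dominable_weights:
  fixes v r :: "nat \<Rightarrow> nat \<Rightarrow> nat"
  assumes fin: "finite A" "finite B" and disj: "A \<inter> B = {}" and card_A: "card A \<le> w"
    and K: "0 < K" and v0: "\<And>a. a \<le> card A \<Longrightarrow> v a 0 = 0"
    and row: "\<And>s d. s \<le> card A \<Longrightarrow> 0 < d \<Longrightarrow> d \<le> card B \<Longrightarrow>
      K \<le> r s d * binsum s (\<lambda>a. binsum d (\<lambda>e. binsum e (\<lambda>q.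
                     if a + e + q \<le> w then v a e * 2 ^ (e - q) else 0)))"
    and col: "\<And>a e. a \<le> card A \<Longrightarrow> 0 < e \<Longrightarrow> e \<le> card B \<Longrightarrow> a + e \<le> w \<Longrightarrow>
      v a e * binsum (card A - a) (\<lambda>i. binsum (card B - e) (\<lambda>j. r (a + i) (e + j))) \<le> K"
  shows "dominable A B w"
proof -
  \<comment> \<open>Sources with empty \<open>B\<close>-part are left out: they are mapped
    identically below, and \<open>v a 0 = 0\<close> keeps their images free.\<close>
  define X where "X = Pow A \<times> (Pow B - {{}})"
  define Y where "Y = (SIGMA T:Pow A. SIGMA E:Pow B. SIGMA R:Pow E. Pow (E - R))"
  define f where "f = (\<lambda>(S1 :: 'a set, S2 :: 'a set) (T :: 'a set, E :: 'a set, R :: 'a set, Q :: 'a set).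
    if T \<subseteq> S1 \<and> E \<subseteq> S2 \<and> card T + card E + card R \<le> w
    then r (card S1) (card S2) * v (card T) (card E) else 0)"
  have finY: "finite Y"
    unfolding Y_def using fin by (intro finite_SigmaI) (auto intro: finite_subset)
  have finX: "finite X"
    unfolding X_def using fin by auto
  have rowf: "K \<le> (\<Sum>y\<in>Y. f x y)" if "x \<in> X" for x
  proof -
    obtain S1 S2 where x: "x = (S1, S2)" and S: "S1 \<subseteq> A" "S2 \<subseteq> B" "S2 \<noteq> {}"
      using \<open>x \<in> X\<close> by (auto simp: X_def)
    have finS: "finite S1" "finite S2" using S fin finite_subset by auto
    define Y' where "Y' = (SIGMA T:Pow S1. SIGMA E:Pow S2. SIGMA R:Pow E. Pow (E - R))"
    let ?g = "\<lambda>a e q. if a + e + q \<le> w then v a e * 2 ^ (e - q) else 0"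
    have in_E: "(\<Sum>R\<in>Pow E. \<Sum>Q\<in>Pow (E - R). f x (T, E, R, Q)) =
        r (card S1) (card S2) * binsum (card E) (\<lambda>q. ?g (card T) (card E) q)"
      if "T \<in> Pow S1" "E \<in> Pow S2" for T E
    proof -
      have finE: "finite E" using that finS finite_subset by auto
      \<comment> \<open>The factor \<open>2 ^ (e - q)\<close> counts the choices of \<open>Q\<close>
        inside \<open>E - R\<close>.\<close>
      have "(\<Sum>R\<in>Pow E. \<Sum>Q\<in>Pow (E - R). f x (T, E, R, Q)) =
          (\<Sum>R\<in>Pow E. r (card S1) (card S2) * ?g (card T) (card E) (card R))"
        using that finE
        by (intro sum.cong) (auto simp: f_def x card_Pow card_Diff_subset finite_subset)
      also have "\<dots> = r (card S1) (card S2) * (\<Sum>R\<in>Pow E. ?g (card T) (card E) (card R))"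
        by (simp only: sum_distrib_left)
      also have "(\<Sum>R\<in>Pow E. ?g (card T) (card E) (card R)) = binsum (card E) (\<lambda>q. ?g (card T) (card E) q)"
        by (rule sum_Pow_card[OF finE])
      finally show ?thesis .
    qed
    have "K \<le> r (card S1) (card S2) * binsum (card S1) (\<lambda>a. binsum (card S2) (\<lambda>e. binsum e (?g a e)))"
      using S fin finS by (intro row) (auto simp: card_mono card_gt_0_iff)
    also have "binsum (card S1) (\<lambda>a. binsum (card S2) (\<lambda>e. binsum e (?g a e))) =
        (\<Sum>T\<in>Pow S1. \<Sum>E\<in>Pow S2. binsum (card E) (?g (card T) (card E)))"
      by (simp only: sum_Pow_card[OF finS(1), symmetric] sum_Pow_card[OF finS(2), symmetric])
    also have "r (card S1) (card S2) * \<dots> =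
        (\<Sum>T\<in>Pow S1. \<Sum>E\<in>Pow S2. r (card S1) (card S2) * binsum (card E) (?g (card T) (card E)))"
      by (simp only: sum_distrib_left)
    also have "\<dots> = (\<Sum>T\<in>Pow S1. \<Sum>E\<in>Pow S2. \<Sum>R\<in>Pow E. \<Sum>Q\<in>Pow (E - R). f x (T, E, R, Q))"
      by (intro sum.cong refl) (simp only: in_E)
    also have "\<dots> = (\<Sum>T\<in>Pow S1. \<Sum>E\<in>Pow S2. \<Sum>(R, Q)\<in>(SIGMA R:Pow E. Pow (E - R)). f x (T, E, R, Q))"
      using finS by (intro sum.cong refl sum.Sigma) (auto intro: finite_subset)
    also have "\<dots> = (\<Sum>T\<in>Pow S1. \<Sum>(E, R, Q)\<in>(SIGMA E:Pow S2. SIGMA R:Pow E. Pow (E - R)). f x (T, E, R, Q))"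
      using finS by (intro sum.cong refl sum.Sigma) (auto intro: finite_subset)
    also have "\<dots> = (\<Sum>(T, E, R, Q)\<in>Y'. f x (T, E, R, Q))"
      unfolding Y'_def using finS by (intro sum.Sigma ballI finite_SigmaI) (auto intro: finite_subset)
    also have "\<dots> = (\<Sum>y\<in>Y'. f x y)"
      by (simp add: split_def)
    also have "\<dots> \<le> (\<Sum>y\<in>Y. f x y)"
      using S finY by (intro sum_mono2) (auto simp: Y_def Y'_def)
    finally show ?thesis .
  qed
  have colf: "(\<Sum>x\<in>X. f x y) \<le> K" if "y \<in> Y" for y
  proof -
    obtain T E R Q where y: "y = (T, E, R, Q)" and T: "T \<subseteq> A" and E: "E \<subseteq> B"
      using \<open>y \<in> Y\<close> by (auto simp: Y_def)
    have finTE: "finite T" "finite E" using T E fin finite_subset by auto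
    show ?thesis
    \<comment> \<open>Otherwise the column carries no weight: by \<open>v0\<close> if
      \<open>E\<close> is empty, and by the size restriction in \<open>f\<close> if the support is
      too large.\<close>
    proof (cases "E \<noteq> {} \<and> card T + card E \<le> w")
      case True
      define X' where "X' = {S. T \<subseteq> S \<and> S \<subseteq> A} \<times> {S. E \<subseteq> S \<and> S \<subseteq> B}"
      have "(\<Sum>x\<in>X. f x y) = (\<Sum>x\<in>X'. f x y)"
        using finX True by (intro sum.mono_neutral_right) (auto simp: X_def X'_def f_def y split: if_splits)
      \<comment> \<open>Dropping the size restriction of \<open>f\<close> makes the bound
        independent of \<open>R\<close>.\<close>
      also have "\<dots> \<le> (\<Sum>(S1, S2)\<in>X'. r (card S1) (card S2) * v (card T) (card E))"
        by (intro sum_mono) (auto simp: f_def y)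
      also have "\<dots> = (\<Sum>S1 | T \<subseteq> S1 \<and> S1 \<subseteq> A. \<Sum>S2 | E \<subseteq> S2 \<and> S2 \<subseteq> B.
          r (card S1) (card S2)) * v (card T) (card E)"
        unfolding X'_def sum.cartesian_product[symmetric] by (simp add: sum_distrib_right)
      also have "\<dots> = v (card T) (card E) * binsum (card A - card T) (\<lambda>i.
          binsum (card B - card E) (\<lambda>j. r (card T + i) (card E + j)))"
        using sum_supersets_card[OF fin(1) T, of "\<lambda>s. \<Sum>S2 | E \<subseteq> S2 \<and> S2 \<subseteq> B. r s (card S2)"]
        by (simp add: sum_supersets_card[OF fin(2) E])
      also have "\<dots> \<le> K"
        using True T E fin finTE by (intro col) (auto simp: card_mono card_gt_0_iff)
      finally show ?thesis .
    next
      case False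
      then have "f x y = 0" for x
        using v0[OF card_mono[OF fin(1) T]] by (auto simp: f_def y split: prod.splits)
      then show ?thesis by simp
    qed
  qed
  obtain g where g: "inj_on g X" and gY: "\<And>x. x \<in> X \<Longrightarrow> g x \<in> Y \<and> 0 < f x (g x)"
    using fractional_matching[OF finX finY K rowf colf] by blast
  define code where "code = (\<lambda>(T, E, R, Q). (T \<union> R \<union> Q, E - Q :: 'a set))"
  have g_props: "\<exists>T E R Q. g (S1, S2) = (T, E, R, Q) \<and> T \<subseteq> S1 \<and> E \<subseteq> S2 \<and> E \<noteq> {} \<and>
      R \<subseteq> E \<and> Q \<subseteq> E - R \<and> card T + card E + card R \<le> w" if "(S1, S2) \<in> X" for S1 S2
    using gY[OF that] v0 card_mono[OF fin(1)] by (auto simp: Y_def f_def split: if_splits)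
  have inj_code: "inj_on code Y"
  proof (rule inj_on_inverseI)
    fix y assume "y \<in> Y"
    \<comment> \<open>The decoder: points in both layers form \<open>R\<close>, points of
      \<open>B\<close> in the first layer only form \<open>Q\<close>, and \<open>T\<close> is the
      part of the first layer in \<open>A\<close>.\<close>
    then show "(\<lambda>(P, Q). (P \<inter> A, (P \<inter> B) \<union> Q, P \<inter> Q, P \<inter> B - Q)) (code y) = y"
      using disj by (auto simp: Y_def code_def)
  qed
  define \<phi> where "\<phi> = (\<lambda>S. if S \<inter> B = {} then (S, {}) else code (g (S \<inter> A, S \<inter> B)))"
  have X: "(S \<inter> A, S \<inter> B) \<in> X" if "S \<inter> B \<noteq> {}" for S
    using that by (auto simp: X_def)
  have code_B: "(fst (code (g x)) \<union> snd (code (g x))) \<inter> B \<noteq> {}" if "x \<in> X" for x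
  proof -
    obtain S1 S2 where x: "x = (S1, S2)" by force
    then show ?thesis
      using g_props[of S1 S2] that by (auto simp: code_def X_def) blast
  qed
  \<comment> \<open>The images of the two kinds of sources are told apart by whether they meet
    \<open>B\<close>.\<close>
  have neq: "\<phi> S \<noteq> \<phi> S'" if "S \<inter> B = {}" "S' \<inter> B \<noteq> {}" for S S'
  proof
    assume "\<phi> S = \<phi> S'"
    then have "code (g (S' \<inter> A, S' \<inter> B)) = (S, {})" using that by (simp add: \<phi>_def)
    then show False using code_B[OF X[OF that(2)]] that(1) by simp
  qed
  have "inj_on \<phi> (Pow (A \<union> B))"
  proof (rule inj_onI)
    fix S S' assume S: "S \<in> Pow (A \<union> B)" "S' \<in> Pow (A \<union> B)" and eq: "\<phi> S = \<phi> S'"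
    show "S = S'"
    proof (cases "S \<inter> B = {}"; cases "S' \<inter> B = {}")
      assume "S \<inter> B \<noteq> {}" "S' \<inter> B \<noteq> {}"
      then have "g (S \<inter> A, S \<inter> B) = g (S' \<inter> A, S' \<inter> B)"
        using eq gY X inj_onD[OF inj_code] by (simp add: \<phi>_def)
      then have "S \<inter> A = S' \<inter> A \<and> S \<inter> B = S' \<inter> B"
        using inj_onD[OF g] X \<open>S \<inter> B \<noteq> {}\<close> \<open>S' \<inter> B \<noteq> {}\<close> by blast
      then show ?thesis using S by blast
    qed (use eq neq[of S S'] neq[of S' S] in \<open>auto simp: \<phi>_def\<close>)
  qed
  moreover have "fst (\<phi> S) \<subseteq> S \<and> snd (\<phi> S) \<subseteq> S \<inter> B \<and>
      card (fst (\<phi> S)) + card (snd (\<phi> S)) \<le> w" if S: "S \<in> Pow (A \<union> B)" for S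
  proof (cases "S \<inter> B = {}")
    case True
    then have "S \<subseteq> A" using S by blast
    then have "card S \<le> w" using card_A card_mono[OF fin(1), of S] by linarith
    then show ?thesis using True by (simp add: \<phi>_def)
  next
    case False
    from g_props[OF X[OF this]]
    obtain T E R Q where *: "g (S \<inter> A, S \<inter> B) = (T, E, R, Q)" "T \<subseteq> S \<inter> A" "E \<subseteq> S \<inter> B"
        "R \<subseteq> E" "Q \<subseteq> E - R" "card T + card E + card R \<le> w"
      by blast
    have "E \<subseteq> B" "R \<subseteq> B" "Q \<subseteq> B" using *(3-5) by auto
    then have finRQ: "finite E" "finite R" "finite Q"
      using finite_subset[OF _ fin(2)] by simp_all
    have "card (T \<union> R \<union> Q) + card (E - Q) \<le> card T + card R + card Q + card (E - Q)"
      using card_Un_le[of T R] card_Un_le[of "T \<union> R" Q] by linarith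
    also have "\<dots> = card T + card E + card R"
    proof -
      have "Q \<subseteq> E" using *(5) by blast
      then show ?thesis
        using card_mono[OF finRQ(1)] by (simp add: card_Diff_subset finRQ)
    qed
    finally show ?thesis
      using * False by (auto simp: \<phi>_def code_def)
  qed
  ultimately show ?thesis unfolding dominable_def by blast
qed

section \<open>Certificates that can be evaluated\<close>

text \<open>These are the hypotheses of \<open>dominable_weights\<close> for
  \<open>card A = w\<close> and \<open>card B = 2 * w\<close>, with quantifiers over explicit lists
  so that they can be computed. Row \<open>a\<close> of \<open>v\<close> need only reach
  \<open>e = w - a\<close>, as the test \<open>a + e + q \<le> w\<close> guards every later
  entry.\<close>

definition feasible :: "nat \<Rightarrow> nat \<Rightarrow> nat list list \<Rightarrow> nat list list \<Rightarrow> bool" where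
  "feasible w K v r \<longleftrightarrow>
     (\<forall>s\<in>set [0..<w + 1]. \<forall>d\<in>set [1..<2 * w + 1].
        K \<le> r ! s ! d * binsum s (\<lambda>a. binsum d (\<lambda>e. binsum e (\<lambda>q.
               if a + e + q \<le> w then v ! a ! e * 2 ^ (e - q) else 0)))) \<and>
     (\<forall>a\<in>set [0..<w + 1]. v ! a ! 0 = 0 \<and> (\<forall>e\<in>set [1..<w + 1 - a].
        v ! a ! e * binsum (w - a) (\<lambda>i. binsum (2 * w - e) (\<lambda>j. r ! (a + i) ! (e + j))) \<le> K))"

lemma dominable_feasible:
  assumes "finite A" "finite B" "A \<inter> B = {}" "card A = w" "card B = 2 * w"
    and "0 < K" "feasible w K v r"
  shows "dominable A B w"
proof (rule dominable_weights[where K = K and r = "\<lambda>s d. r ! s ! d" and v = "\<lambda>a e. v ! a ! e"])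
  fix s d assume "s \<le> card A" "0 < d" "d \<le> card B"
  then have "s \<in> set [0..<w + 1]" "d \<in> set [1..<2 * w + 1]" using assms by auto
  then show "K \<le> r ! s ! d * binsum s (\<lambda>a. binsum d (\<lambda>e. binsum e (\<lambda>q.
      if a + e + q \<le> w then v ! a ! e * 2 ^ (e - q) else 0)))"
    using assms(7) unfolding feasible_def by blast
next
  fix a e assume "a \<le> card A" "0 < e" "e \<le> card B" "a + e \<le> w"
  then have "a \<in> set [0..<w + 1]" "e \<in> set [1..<w + 1 - a]" using assms by auto
  then show "v ! a ! e * binsum (card A - a) (\<lambda>i. binsum (card B - e) (\<lambda>j. r ! (a + i) ! (e + j))) \<le> K"
    using assms(7) unfolding feasible_def assms(4,5) by blast
next
  fix a assume "a \<le> card A"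
  then have "a \<in> set [0..<w + 1]" using assms by auto
  then show "v ! a ! 0 = 0"
    using assms(7) unfolding feasible_def by blast
qed (use assms in auto)

section \<open>Adding and shrinking configurations\<close>

text \<open>The two maps act independently on the two parts of \<open>S\<close>. Intersecting the
  layers of the image with each of the disjoint vertex sets recovers the separate images, and the
  sizes add.\<close>

lemma dominable_Un:
  assumes "dominable A B w" "dominable A' B' w'" and disj: "(A \<union> B) \<inter> (A' \<union> B') = {}"
  shows "dominable (A \<union> A') (B \<union> B') (w + w')"
proof -
  obtain f where f: "inj_on f (Pow (A \<union> B))"
    "\<And>S. S \<subseteq> A \<union> B \<Longrightarrow> fst (f S) \<subseteq> S \<and> snd (f S) \<subseteq> S \<inter> B \<and> card (fst (f S)) + card (snd (f S)) \<le> w"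
    using assms(1) unfolding dominable_def by auto
  obtain g where g: "inj_on g (Pow (A' \<union> B'))"
    "\<And>S. S \<subseteq> A' \<union> B' \<Longrightarrow> fst (g S) \<subseteq> S \<and> snd (g S) \<subseteq> S \<inter> B' \<and> card (fst (g S)) + card (snd (g S)) \<le> w'"
    using assms(2) unfolding dominable_def by auto
  let ?V = "A \<union> B" and ?V' = "A' \<union> B'"
  define \<phi> where "\<phi> = (\<lambda>S. (fst (f (S \<inter> ?V)) \<union> fst (g (S \<inter> ?V')), snd (f (S \<inter> ?V)) \<union> snd (g (S \<inter> ?V'))))"
  have sub: "fst (f (S \<inter> ?V)) \<subseteq> S \<inter> ?V" "snd (f (S \<inter> ?V)) \<subseteq> S \<inter> B"
    "fst (g (S \<inter> ?V')) \<subseteq> S \<inter> ?V'" "snd (g (S \<inter> ?V')) \<subseteq> S \<inter> B'" for S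
    using f(2)[of "S \<inter> ?V"] g(2)[of "S \<inter> ?V'"] by auto
  have "f (S \<inter> ?V) = (fst (\<phi> S) \<inter> ?V, snd (\<phi> S) \<inter> ?V)" for S
    using sub[of S] disj by (intro prod_eqI) (auto simp: \<phi>_def)
  moreover have "g (S \<inter> ?V') = (fst (\<phi> S) \<inter> ?V', snd (\<phi> S) \<inter> ?V')" for S
    using sub[of S] disj by (intro prod_eqI) (auto simp: \<phi>_def)
  ultimately have eqs: "f (S \<inter> ?V) = f (T \<inter> ?V)" "g (S \<inter> ?V') = g (T \<inter> ?V')" if "\<phi> S = \<phi> T" for S T
    using that by metis+
  have "inj_on \<phi> (Pow (?V \<union> ?V'))"
  proof (rule inj_onI)
    fix S T assume S: "S \<in> Pow (?V \<union> ?V')" "T \<in> Pow (?V \<union> ?V')" and "\<phi> S = \<phi> T"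
    then have "S \<inter> ?V = T \<inter> ?V" "S \<inter> ?V' = T \<inter> ?V'"
      using eqs inj_onD[OF f(1)] inj_onD[OF g(1)] by (metis Int_lower2 PowI)+
    then show "S = T" using S by blast
  qed
  moreover have "fst (\<phi> S) \<subseteq> S \<and> snd (\<phi> S) \<subseteq> S \<inter> (B \<union> B') \<and> card (fst (\<phi> S)) + card (snd (\<phi> S)) \<le> w + w'" for S
  proof -
    have "card (fst (\<phi> S)) \<le> card (fst (f (S \<inter> ?V))) + card (fst (g (S \<inter> ?V')))"
      "card (snd (\<phi> S)) \<le> card (snd (f (S \<inter> ?V))) + card (snd (g (S \<inter> ?V')))"
      by (simp_all add: \<phi>_def card_Un_le)
    then show ?thesis
      using f(2)[of "S \<inter> ?V"] g(2)[of "S \<inter> ?V'"] by (auto simp: \<phi>_def)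
  qed
  moreover have "(A \<union> A') \<union> (B \<union> B') = ?V \<union> ?V'" by blast
  ultimately show ?thesis unfolding dominable_def by metis
qed

text \<open>Restricting the map suffices: if \<open>S \<subseteq> A \<union> B'\<close>, then
  \<open>S \<inter> B\<close> lies in \<open>B'\<close> because \<open>A\<close> and
  \<open>B\<close> are disjoint.\<close>

lemma dominable_mono:
  assumes "dominable A B w" "B' \<subseteq> B" "A \<inter> B = {}"
  shows "dominable A B' w"
proof -
  obtain f where f: "inj_on f (Pow (A \<union> B))"
    "\<And>S. S \<subseteq> A \<union> B \<Longrightarrow> fst (f S) \<subseteq> S \<and> snd (f S) \<subseteq> S \<inter> B \<and> card (fst (f S)) + card (snd (f S)) \<le> w"
    using assms(1) unfolding dominable_def by auto
  have "inj_on f (Pow (A \<union> B'))"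
    using f(1) assms(2) by (auto intro: inj_on_subset)
  moreover have "fst (f S) \<subseteq> S \<and> snd (f S) \<subseteq> S \<inter> B' \<and> card (fst (f S)) + card (snd (f S)) \<le> w"
    if "S \<in> Pow (A \<union> B')" for S
    using f(2)[of S] that assms by blast
  ultimately show ?thesis unfolding dominable_def by blast
qed

section \<open>The base cases and all larger \<open>w\<close>\<close>

text \<open>The tables were found by a numerical search: starting from constant weights, the entries of
  \<^term>\<open>v\<close> violating their column bound are rescaled repeatedly, and \<^term>\<open>r\<close> is
  \<^term>\<open>K\<close> divided by the weighted count, rounded up.\<close>

lemma feasible_3: "feasible 3 7000
    [[0, 1, 11, 44],
     [0, 5, 29],
     [0, 15],
     [0]]
    [[0, 2334, 75, 12, 4, 2, 1],
     [0, 389, 30, 7, 3, 2, 1],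
     [0, 112, 16, 5, 2, 1, 1],
     [0, 51, 10, 4, 2, 1, 1]]"
  by code_simp

lemma feasible_4: "feasible 4 60000
    [[0, 1, 12, 56, 111],
     [0, 5, 36, 111],
     [0, 18, 99],
     [0, 57],
     [0]]
    [[0, 20000, 527, 42, 9, 3, 2, 1, 1],
     [0, 3334, 139, 19, 5, 2, 1, 1, 1],
     [0, 690, 48, 10, 3, 2, 1, 1, 1],
     [0, 186, 22, 6, 2, 1, 1, 1, 1],
     [0, 72, 12, 4, 2, 1, 1, 1, 1]]"
  by code_simp

lemma feasible_5: "feasible 5 2000000
    [[0, 1, 19, 107, 253, 253],
     [0, 6, 63, 253, 253],
     [0, 26, 187, 253],
     [0, 97, 253],
     [0, 253],
     [0]]
    [[0, 666667, 11300, 606, 83, 21, 7, 3, 2, 1, 1],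
     [0, 95239, 2565, 198, 39, 12, 5, 2, 1, 1, 1],
     [0, 17095, 659, 85, 21, 7, 3, 2, 1, 1, 1],
     [0, 3437, 235, 42, 12, 5, 2, 1, 1, 1, 1],
     [0, 904, 101, 23, 8, 3, 2, 1, 1, 1, 1],
     [0, 317, 50, 14, 5, 3, 2, 1, 1, 1, 1]]"
  by code_simp

text \<open>Blocks of 3 single and 6 double vertices are split off, which keeps the ratio, as long
  as the remainder has parameter at least 3. This leaves 3, 4 and 5 as base cases.\<close>

lemma dominable_double:
  assumes "finite A" "finite B" "A \<inter> B = {}" "card A = w" "card B = 2 * w" "3 \<le> w"
  shows "dominable A B w"
  using assms
proof (induction w arbitrary: A B rule: less_induct)
  case (less w)
  consider "w = 3" | "w = 4" | "w = 5" | "6 \<le> w" using less.prems by linarith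
  then show ?case
  proof cases
    case 4
    have "3 \<le> card A" "6 \<le> card B" using less.prems 4 by auto
    then obtain A' B' where A': "A' \<subseteq> A" "card A' = 3" and B': "B' \<subseteq> B" "card B' = 6"
      by (meson obtain_subset_with_card_n)
    have fin: "finite A'" "finite B'" using A' B' less.prems finite_subset by blast+
    have "dominable A' B' 3"
      using 4 A' B' fin less.prems by (intro less.IH) auto
    moreover have "dominable (A - A') (B - B') (w - 3)"
      using 4 A' B' fin less.prems by (intro less.IH) (auto simp: card_Diff_subset)
    moreover have "(A' \<union> B') \<inter> (A - A' \<union> (B - B')) = {}"
      using A' B' less.prems(3) by blast
    ultimately have "dominable (A' \<union> (A - A')) (B' \<union> (B - B')) (3 + (w - 3))"
      by (rule dominable_Un)
    then show ?thesis
      using A' B' 4 by (simp add: Un_absorb1)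
  next
    case 1
    then show ?thesis using less.prems dominable_feasible[OF _ _ _ _ _ _ feasible_3, of A B] by simp
  next
    case 2
    then show ?thesis using less.prems dominable_feasible[OF _ _ _ _ _ _ feasible_4, of A B] by simp
  next
    case 3
    then show ?thesis using less.prems dominable_feasible[OF _ _ _ _ _ _ feasible_5, of A B] by simp
  qed
qed

section \<open>Translation into domination mappings\<close>

lemma cube_eqI:
  assumes "y \<in> cube n" "z \<in> cube n" "{j \<in> {1..n}. y j \<noteq> 0} = {j \<in> {1..n}. z j \<noteq> 0}"
  shows "y = z"
proof (rule PiE_ext)
  show "y \<in> {1..n} \<rightarrow>\<^sub>E {0, 1}" "z \<in> {1..n} \<rightarrow>\<^sub>E {0, 1}"
    using assms by (simp_all add: cube_def)
  fix j assume j: "j \<in> {1..n}"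
  then have "y j \<in> {0, 1}" "z j \<in> {0, 1}"
    using assms by (auto simp: cube_def)
  moreover have "y j \<noteq> 0 \<longleftrightarrow> z j \<noteq> 0" using assms(3) j by blast
  ultimately show "y j = z j" by auto
qed

text \<open>Left vertex \<open>i\<close> is joined to right vertex \<open>i\<close>, and for
  \<open>i > w\<close> also to \<open>t i\<close>. The values \<open>t i\<close> fill exactly the
  range from \<open>m + 1\<close> to \<open>2 * m - w\<close>, so the two layers are stored in
  disjoint ranges.\<close>

lemma domination_mapping_of_dominable:
  assumes dom: "dominable {1..w} {w + 1..m} w" and "w \<le> m"
  shows "\<exists>\<phi>. domination_mapping m (2 * m - w) w \<phi>"
proof -
  let ?n = "2 * m - w"
  have Un: "{1..w} \<union> {w + 1..m} = {1..m}" using \<open>w \<le> m\<close> by auto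
  obtain f where inj_f: "inj_on f (Pow {1..m})" and
    f: "\<And>S. S \<subseteq> {1..m} \<Longrightarrow> fst (f S) \<subseteq> S \<and> snd (f S) \<subseteq> S \<inter> {w + 1..m} \<and>
        card (fst (f S)) + card (snd (f S)) \<le> w"
    using dom unfolding dominable_def Un by auto
  define supp where "supp = (\<lambda>x :: nat \<Rightarrow> nat. {i \<in> {1..m}. x i \<noteq> 0})"
  define P where "P = (\<lambda>x. fst (f (supp x)))"
  define Q where "Q = (\<lambda>x. snd (f (supp x)))"
  define t where "t = (\<lambda>i. i + (m - w))"
  define T where "T = (\<lambda>x. P x \<union> t ` Q x)"
  define \<phi> where "\<phi> = (\<lambda>x. \<lambda>j\<in>{1..?n}. if j \<in> T x then 1 else 0 :: nat)"
  define E where "E = (\<lambda>i. (i, i)) ` {1..m} \<union> (\<lambda>i. (i, t i)) ` {w + 1..m}"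
  have PQ: "P x \<subseteq> supp x" "Q x \<subseteq> supp x \<inter> {w + 1..m}" "card (P x) + card (Q x) \<le> w" for x
  proof -
    have "supp x \<subseteq> {1..m}" by (auto simp: supp_def)
    from f[OF this] show "P x \<subseteq> supp x" "Q x \<subseteq> supp x \<inter> {w + 1..m}" "card (P x) + card (Q x) \<le> w"
      by (auto simp: P_def Q_def)
  qed
  have P_le: "i \<in> {1..m}" if "i \<in> P x" for i x
    using PQ(1)[of x] that by (auto simp: supp_def)
  have t_gt: "m < t i \<and> t i \<le> ?n" if "i \<in> {w + 1..m}" for i
    using that by (auto simp: t_def)
  have Q_gt: "m < t i \<and> t i \<le> ?n" if "i \<in> Q x" for i x
    using that PQ(2)[of x] by (intro t_gt) blast
  have inj_t: "inj t" by (simp add: t_def inj_def)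
  have T_sub: "T x \<subseteq> {1..?n}" for x
    using P_le[of _ x] Q_gt[of _ x] \<open>w \<le> m\<close> by (fastforce simp: T_def)
  \<comment> \<open>Both layers can be read off \<open>T x\<close>, which makes
    \<open>\<phi>\<close> injective.\<close>
  have P_T: "P x = T x \<inter> {1..m}" for x
    using P_le[of _ x] Q_gt[of _ x] by (fastforce simp: T_def)
  have Q_T: "Q x = {i. t i \<in> T x \<and> m < t i}" for x
    using P_le[of _ x] Q_gt[of _ x] inj_t by (fastforce simp: T_def inj_def)
  have supp_\<phi>: "{j \<in> {1..?n}. \<phi> x j \<noteq> 0} = T x" for x
    using T_sub[of x] by (auto simp: \<phi>_def)
  have "\<phi> x \<in> hamming_ball ?n w" for x
  proof -
    have fin: "finite (P x)" "finite (Q x)"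
      using PQ(1,2)[of x] by (auto simp: supp_def intro: finite_subset)
    have "wt ?n (\<phi> x) = card (T x)"
      by (simp only: wt_def supp_\<phi>)
    also have "\<dots> \<le> card (P x) + card (t ` Q x)"
      unfolding T_def by (rule card_Un_le)
    also have "\<dots> \<le> w"
      using PQ(3)[of x] card_image_le[OF fin(2), of t] by linarith
    finally have "wt ?n (\<phi> x) \<le> w" .
    moreover have "\<phi> x \<in> cube ?n"
      by (auto simp: \<phi>_def cube_def)
    ultimately show ?thesis
      by (simp add: hamming_ball_def)
  qed
  moreover have "inj_on \<phi> (cube m)"
  proof (rule inj_onI)
    fix x y assume xy: "x \<in> cube m" "y \<in> cube m" and "\<phi> x = \<phi> y"
    then have "T x = T y" using supp_\<phi>[of x] supp_\<phi>[of y] by simp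
    then have "P x = P y" "Q x = Q y" using P_T Q_T by simp_all
    then have "f (supp x) = f (supp y)" by (simp add: P_def Q_def prod_eq_iff)
    then have "supp x = supp y" by (rule inj_onD[OF inj_f]) (auto simp: supp_def)
    then show "x = y" using xy by (intro cube_eqI) (auto simp: supp_def)
  qed
  moreover have "domination_graph m ?n E"
  proof -
    have "\<exists>i\<in>{1..m}. (i, j) \<in> E" if "j \<in> {1..?n}" for j
    proof (cases "j \<le> m")
      case False
      define i where "i = j - (m - w)"
      have i: "j = t i" "i \<in> {w + 1..m}"
        using False that \<open>w \<le> m\<close> by (auto simp: t_def i_def)
      then have "(i, j) \<in> E" unfolding E_def by blast
      then show ?thesis using i by auto
    next
      case True
      then have "j \<in> {1..m}" using that by simp
      moreover from this have "(j, j) \<in> E" unfolding E_def by blast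
      ultimately show ?thesis by blast
    qed
    moreover have "E \<subseteq> {1..m} \<times> {1..?n}"
      using t_gt \<open>w \<le> m\<close> by (fastforce simp: E_def)
    ultimately show ?thesis by (auto simp: domination_graph_def)
  qed
  moreover have "dominating m E \<phi>"
  proof -
    have "\<phi> x j = 0" if edge: "(i, j) \<in> E" and x_i: "x i = 0" for x i j
    proof -
      have i: "i \<notin> P x" "i \<notin> Q x" using PQ(1,2)[of x] x_i by (auto simp: supp_def)
      consider "j = i" "i \<in> {1..m}" | "j = t i" "i \<in> {w + 1..m}"
        using edge unfolding E_def by blast
      then have "j \<notin> T x"
      proof cases
        case 1 then show ?thesis using i P_T by blast
      next
        case 2 then show ?thesis using i Q_T t_gt by blast
      qed
      moreover have "j \<in> {1..?n}"
        using edge \<open>domination_graph m ?n E\<close> by (auto simp: domination_graph_def)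
      ultimately show ?thesis by (simp add: \<phi>_def)
    qed
    then show ?thesis by (auto simp: dominating_def)
  qed
  ultimately show ?thesis unfolding domination_mapping_def by blast
qed

section \<open>The lower bound\<close>

lemma domination_mapping_bound:
  assumes "domination_mapping m n w \<phi>"
  shows "2 * m - w \<le> n"
proof -
  obtain E where ball: "\<phi> \<in> cube m \<rightarrow> hamming_ball n w" and inj: "inj_on \<phi> (cube m)"
    and graph: "domination_graph m n E" and dom: "dominating m E \<phi>"
    using assms by (auto simp: domination_mapping_def)
  \<comment> \<open>No right vertex is isolated, so an edge can be chosen at each one; the fibres of
    \<open>h\<close> then partition \<open>{1..n}\<close>.\<close>
  obtain h where h: "\<And>j. j \<in> {1..n} \<Longrightarrow> h j \<in> {1..m} \<and> (h j, j) \<in> E"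
    using graph unfolding domination_graph_def by metis
  define fib where "fib = (\<lambda>i. {j \<in> {1..n}. h j = i})"
  define \<chi> where "\<chi> = (\<lambda>S. \<lambda>i\<in>{1..m}. if i \<in> S then 1 else 0 :: nat)"
  define D where "D = (\<lambda>S. {j \<in> {1..n}. \<phi> (\<chi> S) j \<noteq> 0})"
  have \<chi>: "\<chi> S \<in> cube m" for S
    by (auto simp: \<chi>_def cube_def)
  have inj_D: "inj_on D (Pow {1..m})"
  proof (rule inj_onI)
    fix S S' assume S: "S \<in> Pow {1..m}" "S' \<in> Pow {1..m}" and "D S = D S'"
    then have "\<phi> (\<chi> S) = \<phi> (\<chi> S')"
      using ball \<chi> by (intro cube_eqI[of _ n]) (auto simp: D_def hamming_ball_def)
    then have "\<chi> S = \<chi> S'" using inj \<chi> by (auto dest: inj_onD)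
    moreover have "R = {i \<in> {1..m}. \<chi> R i = 1}" if "R \<in> Pow {1..m}" for R
      using that by (auto simp: \<chi>_def)
    ultimately show "S = S'" using S by metis
  qed
  have card_D: "card (D S) \<le> w" for S
    using ball \<chi>[of S] by (auto simp: D_def hamming_ball_def wt_def)
  have D_sub: "D S \<subseteq> (\<Union>i\<in>S. fib i)" for S
  proof
    fix j assume "j \<in> D S"
    then have j: "j \<in> {1..n}" "\<phi> (\<chi> S) j \<noteq> 0" by (auto simp: D_def)
    then have "\<chi> S (h j) \<noteq> 0"
      using h[OF j(1)] dom \<chi> by (force simp: dominating_def)
    then show "j \<in> (\<Union>i\<in>S. fib i)"
      using h[OF j(1)] j(1) by (auto simp: \<chi>_def fib_def split: if_splits)
  qed
  have fin: "finite (fib i)" for i by (simp add: fib_def)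
  \<comment> \<open>\<open>D {}\<close> is empty and \<open>D {i}\<close> lies in
    \<open>fib i\<close>, so injectivity of \<open>D\<close> forces \<open>fib i\<close> to be
    nonempty.\<close>
  have fib_pos: "0 < card (fib i)" if "i \<in> {1..m}" for i
  proof -
    have "D {i} \<noteq> D {}" using that inj_onD[OF inj_D, of "{i}" "{}"] by auto
    then have "fib i \<noteq> {}" using D_sub[of "{i}"] D_sub[of "{}"] by auto
    then show ?thesis using fin by (simp add: card_gt_0_iff)
  qed
  define Z where "Z = {i \<in> {1..m}. card (fib i) \<le> 1}"
  have "card Z \<le> w"
  proof (rule ccontr)
    assume "\<not> card Z \<le> w"
    then obtain W where W: "W \<subseteq> Z" "card W = w + 1" "finite W"
      using obtain_subset_with_card_n[of "w + 1" Z] by auto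
    define L where "L = (\<Union>i\<in>W. fib i)"
    have finL: "finite L" using W fin by (simp add: L_def)
    have "card L \<le> (\<Sum>i\<in>W. card (fib i))"
      unfolding L_def using W by (intro card_UN_le) auto
    also have "\<dots> \<le> (\<Sum>i\<in>W. 1)"
      using W by (intro sum_mono) (auto simp: Z_def)
    finally have card_L: "card L \<le> w + 1" using W by simp
    have "D ` Pow W \<subseteq> {T \<in> Pow L. card T \<le> w}"
    proof -
      have "D S \<subseteq> L" if "S \<subseteq> W" for S
        using D_sub[of S] that by (auto simp: L_def)
      then show ?thesis using card_D by auto
    qed
    then have "card (D ` Pow W) \<le> card {T \<in> Pow L. card T \<le> w}"
      using finL by (intro card_mono) auto
    moreover have "card (D ` Pow W) = 2 ^ (w + 1)"
    proof -
      have "Pow W \<subseteq> Pow {1..m}" using W by (auto simp: Z_def)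
      then have "inj_on D (Pow W)" using inj_D inj_on_subset by blast
      then show ?thesis using W by (simp add: card_image card_Pow)
    qed
    \<comment> \<open>If \<open>L\<close> has \<open>w + 1\<close> elements, \<open>L\<close> itself
      is too large to be an image; if it has fewer, there are at most \<open>2 ^ w\<close> subsets
      in all.\<close>
    moreover have "card {T \<in> Pow L. card T \<le> w} < 2 ^ (w + 1)"
    proof (cases "card L = w + 1")
      case True
      then have "L \<notin> {T \<in> Pow L. card T \<le> w}" by simp
      then have "{T \<in> Pow L. card T \<le> w} \<subset> Pow L" by blast
      then have "card {T \<in> Pow L. card T \<le> w} < card (Pow L)"
        using finL by (intro psubset_card_mono) auto
      then show ?thesis using True finL by (simp add: card_Pow)
    next
      case False
      have "card {T \<in> Pow L. card T \<le> w} \<le> card (Pow L)"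
        using finL by (intro card_mono) auto
      also have "\<dots> \<le> 2 ^ w"
        using False card_L finL by (simp add: card_Pow)
      also have "\<dots> < 2 ^ (w + 1)" by simp
      finally show ?thesis .
    qed
    ultimately show False by simp
  qed
  \<comment> \<open>Adding 1 on \<open>Z\<close> raises every fibre size to at least 2, and the
    total correction is \<open>card Z \<le> w\<close>.\<close>
  have "2 * m = (\<Sum>i\<in>{1..m}. 2)" by simp
  also have "\<dots> \<le> (\<Sum>i\<in>{1..m}. card (fib i) + (if i \<in> Z then 1 else 0))"
    by (intro sum_mono) (use fib_pos in \<open>force simp: Z_def\<close>)
  also have "\<dots> = (\<Sum>i\<in>{1..m}. card (fib i)) + card ({1..m} \<inter> Z)"
    by (simp add: sum.distrib sum.If_cases)
  also have "{1..m} \<inter> Z = Z" by (auto simp: Z_def)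
  also have "(\<Sum>i\<in>{1..m}. card (fib i)) = card (\<Union>i\<in>{1..m}. fib i)"
    by (rule card_UN_disjoint[symmetric]) (auto simp: fib_def)
  also have "(\<Union>i\<in>{1..m}. fib i) = {1..n}"
    using h by (auto simp: fib_def)
  finally show ?thesis using \<open>card Z \<le> w\<close> by simp
qed

theorem theorem11:
  fixes m w :: nat
  assumes "w \<ge> 3" and "w \<le> m" and "m \<le> 3 * w"
  shows "nu m w = 2 * m - w"
  unfolding nu_def
proof (rule Least_equality)
  have "dominable {1..w} {w + 1..3 * w} w"
    using assms by (intro dominable_double) auto
  then have "dominable {1..w} {w + 1..m} w"
    by (rule dominable_mono) (use assms in auto)
  then show "\<exists>\<phi>. domination_mapping m (2 * m - w) w \<phi>"
    using assms by (intro domination_mapping_of_dominable)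
next
  fix n assume "\<exists>\<phi>. domination_mapping m n w \<phi>"
  then show "2 * m - w \<le> n" using domination_mapping_bound by blast
qed

end
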